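(* Let $w\in\mathfrak S_n$ and let $P_w\in\mathrm{SBT}(w)$ be the super-Yamanouchi tableau. Then for any $R\in\mathrm{SBT}(w)$ there exists a sequence $f=f_{\mathrm{inv}(R)}\cdots f_1$ of Coxeter moves (each $f_j$ some $\mathfrak c_i$ or $\mathfrak b_i$) such that $f(P_w)=R$, and for any sequence $g=g_m\cdots g_1$ of Coxeter moves with $g(P_w)=R$ we have $m\ge\mathrm{inv}(R)$.
   Context: $\ell(w)$ is the number of pairs $i<j$ with $w_i>w_j$. The Rothe diagram $\mathbb D(w)=\{(i,w_j)\mid i<j,\ w_i>w_j\}$, the cell $(i,w_j)$ lying in row $i$ (rows numbered bottom to top) and column $w_j$; it has $\ell(w)$ cells. A standard balanced tableau of shape $\mathbb D(w)$ is a bijective filling of its cells with $\{1,\ldots,\ell(w)\}$ such that for every cell, the number of cells to its right in the same row with larger entry equals the number of cells above it in the same column with smaller entry; $\mathrm{SBT}(w)$ is the set of these. The super-Yamanouchi tableau $P_w$ is the filling whose reverse row reading word (reading each row from right to left, rows from bottom to top) is $1,2,\ldots,\ell(w)$; it is a standard balanced tableau. Coxeter moves: $\mathfrak c_i$ ($1\le i<\ell(w)$) exchanges entries $i$ and $i+1$ if they are neither in the same row nor the same column, else is the identity; $\mathfrak b_i$ ($1<i<\ell(w)$) exchanges entries $i-1$ and $i+1$ if one of them lies in the same column as $i$ and above it and the other lies in the same row as $i$ and to its right, else is the identity. The inversion number $\mathrm{inv}(R)$ is the number of pairs of entries $i<j$ such that $i$ lies in a strictly higher row than $j$ and in a different column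 from $j$. *)

theory Defs
  imports "HOL-Combinatorics.Permutations"
begin

text \<open>A permutation in one-line notation is a function \<open>w\<close> with \<open>w permutes {1..n}\<close>.
  A cell is a pair (row, column); rows are numbered bottom to top and columns left to right,
  so \<^emph>\<open>above\<close> means larger first component and \<^emph>\<open>right\<close> means larger second component.\<close>

type_synonym cell = "nat \<times> nat"
type_synonym filling = "cell \<Rightarrow> nat"

definition perm_length :: "nat \<Rightarrow> (nat \<Rightarrow> nat) \<Rightarrow> nat" where
  "perm_length n w = card {(i, j). 1 \<le> i \<and> i < j \<and> j \<le> n \<and> w i > w j}"

definition rothe :: "nat \<Rightarrow> (nat \<Rightarrow> nat) \<Rightarrow> cell set" where
  "rothe n w = {(i, w j) | i j. 1 \<le> i \<and> i < j \<and> j \<le> n \<and> w i > w j}"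

text \<open>A filling of the diagram is a total function that is \<open>0\<close> off the diagram; this makes
  equality of fillings ordinary equality of functions. The value \<open>0\<close> is never an entry.\<close>

definition standard_filling :: "nat \<Rightarrow> (nat \<Rightarrow> nat) \<Rightarrow> filling \<Rightarrow> bool" where
  "standard_filling n w T \<longleftrightarrow>
     bij_betw T (rothe n w) {1..perm_length n w} \<and> (\<forall>c. c \<notin> rothe n w \<longrightarrow> T c = 0)"

definition balanced :: "nat \<Rightarrow> (nat \<Rightarrow> nat) \<Rightarrow> filling \<Rightarrow> bool" where
  "balanced n w T \<longleftrightarrow> (\<forall>(r, c) \<in> rothe n w.
     card {c'. (r, c') \<in> rothe n w \<and> c' > c \<and> T (r, c') > T (r, c)} =
     card {r'. (r', c) \<in> rothe n w \<and> r' > r \<and> T (r', c) < T (r, c)})"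

definition SBT :: "nat \<Rightarrow> (nat \<Rightarrow> nat) \<Rightarrow> filling set" where
  "SBT n w = {T. standard_filling n w T \<and> balanced n w T}"

definition reading_cells :: "nat \<Rightarrow> (nat \<Rightarrow> nat) \<Rightarrow> cell list" where
  "reading_cells n w =
     concat (map (\<lambda>r. map (Pair r) (rev (filter (\<lambda>c. (r, c) \<in> rothe n w) [1..<Suc n]))) [1..<Suc n])"

definition reverse_row_word :: "nat \<Rightarrow> (nat \<Rightarrow> nat) \<Rightarrow> filling \<Rightarrow> nat list" where
  "reverse_row_word n w T = map T (reading_cells n w)"

definition super_yamanouchi :: "nat \<Rightarrow> (nat \<Rightarrow> nat) \<Rightarrow> filling" where
  "super_yamanouchi n w = (THE T. (\<forall>c. c \<notin> rothe n w \<longrightarrow> T c = 0) \<and>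
     reverse_row_word n w T = [1..<Suc (perm_length n w)])"

definition cell_of :: "nat \<Rightarrow> (nat \<Rightarrow> nat) \<Rightarrow> filling \<Rightarrow> nat \<Rightarrow> cell" where
  "cell_of n w T k = inv_into (rothe n w) T k"

definition row_of :: "nat \<Rightarrow> (nat \<Rightarrow> nat) \<Rightarrow> filling \<Rightarrow> nat \<Rightarrow> nat" where
  "row_of n w T k = fst (cell_of n w T k)"

definition col_of :: "nat \<Rightarrow> (nat \<Rightarrow> nat) \<Rightarrow> filling \<Rightarrow> nat \<Rightarrow> nat" where
  "col_of n w T k = snd (cell_of n w T k)"

definition above_in_col :: "nat \<Rightarrow> (nat \<Rightarrow> nat) \<Rightarrow> filling \<Rightarrow> nat \<Rightarrow> nat \<Rightarrow> bool" where
  "above_in_col n w T k i \<longleftrightarrow>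
     col_of n w T k = col_of n w T i \<and> row_of n w T k > row_of n w T i"

definition right_in_row :: "nat \<Rightarrow> (nat \<Rightarrow> nat) \<Rightarrow> filling \<Rightarrow> nat \<Rightarrow> nat \<Rightarrow> bool" where
  "right_in_row n w T k i \<longleftrightarrow>
     row_of n w T k = row_of n w T i \<and> col_of n w T k > col_of n w T i"

definition c_move :: "nat \<Rightarrow> (nat \<Rightarrow> nat) \<Rightarrow> nat \<Rightarrow> filling \<Rightarrow> filling" where
  "c_move n w i T =
     (if row_of n w T i \<noteq> row_of n w T (i + 1) \<and> col_of n w T i \<noteq> col_of n w T (i + 1)
      then transpose i (i + 1) \<circ> T else T)"

definition b_move :: "nat \<Rightarrow> (nat \<Rightarrow> nat) \<Rightarrow> nat \<Rightarrow> filling \<Rightarrow> filling" where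
  "b_move n w i T =
     (if above_in_col n w T (i - 1) i \<and> right_in_row n w T (i + 1) i \<or>
         above_in_col n w T (i + 1) i \<and> right_in_row n w T (i - 1) i
      then transpose (i - 1) (i + 1) \<circ> T else T)"

definition coxeter_moves :: "nat \<Rightarrow> (nat \<Rightarrow> nat) \<Rightarrow> (filling \<Rightarrow> filling) set" where
  "coxeter_moves n w =
     {c_move n w i | i. 1 \<le> i \<and> i < perm_length n w} \<union>
     {b_move n w i | i. 1 < i \<and> i < perm_length n w}"

text \<open>The list \<open>[f\<^sub>1, \<dots>, f\<^sub>m]\<close> acts as \<open>f\<^sub>m \<cdots> f\<^sub>1\<close>.\<close>

definition apply_moves :: "(filling \<Rightarrow> filling) list \<Rightarrow> filling \<Rightarrow> filling" where
  "apply_moves fs T = fold (\<lambda>f U. f U) fs T"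

definition inv_number :: "nat \<Rightarrow> (nat \<Rightarrow> nat) \<Rightarrow> filling \<Rightarrow> nat" where
  "inv_number n w R = card {(i, j). 1 \<le> i \<and> i < j \<and> j \<le> perm_length n w \<and>
     row_of n w R i > row_of n w R j \<and> col_of n w R i \<noteq> col_of n w R j}"

lemma rothe_subset:
  assumes "w permutes {1..n}"
  shows "rothe n w \<subseteq> {1..n} \<times> {1..n}"
proof -
  have "w j \<in> {1..n}" if "1 \<le> j" "j \<le> n" for j
    using that permutes_in_image[OF assms, of j] by simp
  then show ?thesis by (fastforce simp: rothe_def)
qed

lemma card_rothe:
  assumes "w permutes {1..n}"
  shows "card (rothe n w) = perm_length n w"
proof -
  let ?I = "{(i, j). 1 \<le> i \<and> i < j \<and> j \<le> n \<and> w i > w j}"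
  have "rothe n w = (\<lambda>(i, j). (i, w j)) ` ?I"
    by (auto simp: rothe_def)
  moreover have "inj_on (\<lambda>(i, j). (i, w j)) ?I"
    using permutes_inj[OF assms] by (auto simp: inj_on_def dest: injD)
  ultimately show ?thesis
    by (simp add: card_image perm_length_def)
qed

lemma set_reading_cells:
  assumes "w permutes {1..n}"
  shows "set (reading_cells n w) = rothe n w"
proof -
  have "r \<in> {1..n} \<and> c \<in> {1..n}" if "(r, c) \<in> rothe n w" for r c
    using rothe_subset[OF assms] that by blast
  then show ?thesis by (auto simp: reading_cells_def image_iff less_Suc_eq_le simp del: upt_Suc)
qed

definition read_before :: "cell \<Rightarrow> cell \<Rightarrow> bool" where
  "read_before x y \<longleftrightarrow> fst x < fst y \<or> fst x = fst y \<and> snd x > snd y"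

lemma sorted_reading_cells: "sorted_wrt read_before (reading_cells n w)"
proof -
  have row: "sorted_wrt read_before (map (Pair r) (rev (filter Q [1..<k])))" for r k and Q :: "nat \<Rightarrow> bool"
    by (auto simp: sorted_wrt_map sorted_wrt_rev read_before_def
        intro!: sorted_wrt_filter sorted_wrt_upt)
  have "sorted_wrt read_before
      (concat (map (\<lambda>r. map (Pair r) (rev (filter (Q r) [1..<k]))) [1..<m]))"
    for Q :: "nat \<Rightarrow> nat \<Rightarrow> bool" and k m
  proof (induction m)
    case (Suc m)
    have "read_before (r, c) (m, d)" if "r < m" for r c d
      using that by (simp add: read_before_def)
    with Suc show ?case using row[of m "Q m" k]
      by (cases "m = 0") (auto simp: sorted_wrt_append)
  qed simp
  then show ?thesis unfolding reading_cells_def .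
qed

lemma distinct_reading_cells: "distinct (reading_cells n w)"
  using sorted_reading_cells[of n w]
  by (auto simp: distinct_conv_nth sorted_wrt_iff_nth_less read_before_def neq_iff)
    (metis less_irrefl)+

lemma length_reading_cells:
  assumes "w permutes {1..n}"
  shows "length (reading_cells n w) = perm_length n w"
  using distinct_card[OF distinct_reading_cells[of n w]] set_reading_cells[OF assms] card_rothe[OF assms]
  by simp

lemma super_yamanouchi_ex1:
  assumes "w permutes {1..n}"
  shows "\<exists>!T. (\<forall>c. c \<notin> rothe n w \<longrightarrow> T c = 0) \<and>
     reverse_row_word n w T = [1..<Suc (perm_length n w)]"
proof (rule ex_ex1I)
  let ?L = "reading_cells n w"
  define T where "T c = (case map_of (zip ?L [1..<Suc (perm_length n w)]) c of None \<Rightarrow> 0 | Some k \<Rightarrow> k)" for c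
  have len: "length ?L = length [1..<Suc (perm_length n w)]"
    by (simp add: length_reading_cells[OF assms])
  have "map T ?L = [1..<Suc (perm_length n w)]"
  proof (rule nth_equalityI)
    fix k assume k: "k < length (map T ?L)"
    then have "map_of (zip ?L [1..<Suc (perm_length n w)]) (?L ! k) = Some ([1..<Suc (perm_length n w)] ! k)"
      using map_of_zip_nth[OF len distinct_reading_cells] len by simp
    then show "map T ?L ! k = [1..<Suc (perm_length n w)] ! k"
      using k by (simp add: T_def)
  qed (use len in simp)
  moreover have "T c = 0" if "c \<notin> rothe n w" for c
  proof -
    have "map_of (zip ?L [1..<Suc (perm_length n w)]) c = None"
      using that map_of_zip_is_None[OF len] set_reading_cells[OF assms] by simp
    then show ?thesis by (simp add: T_def)
  qed
  ultimately show "\<exists>T. (\<forall>c. c \<notin> rothe n w \<longrightarrow> T c = 0) \<and>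
      reverse_row_word n w T = [1..<Suc (perm_length n w)]"
    unfolding reverse_row_word_def by blast
next
  fix T U :: filling
  assume T: "(\<forall>c. c \<notin> rothe n w \<longrightarrow> T c = 0) \<and> reverse_row_word n w T = [1..<Suc (perm_length n w)]"
    and U: "(\<forall>c. c \<notin> rothe n w \<longrightarrow> U c = 0) \<and> reverse_row_word n w U = [1..<Suc (perm_length n w)]"
  then have "map T (reading_cells n w) = map U (reading_cells n w)"
    by (simp add: reverse_row_word_def)
  then have "\<forall>c \<in> rothe n w. T c = U c"
    using set_reading_cells[OF assms] by auto
  then show "T = U" using T U by (metis ext)
qed

lemma super_yamanouchi_props:
  assumes "w permutes {1..n}"
  shows "c \<notin> rothe n w \<Longrightarrow> super_yamanouchi n w c = 0"
    and "reverse_row_word n w (super_yamanouchi n w) = [1..<Suc (perm_length n w)]"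
  using theI'[OF super_yamanouchi_ex1[OF assms]] unfolding super_yamanouchi_def by blast+

lemma super_yamanouchi_in_SBT:
  assumes "w permutes {1..n}"
  shows "super_yamanouchi n w \<in> SBT n w"
proof -
  let ?P = "super_yamanouchi n w" and ?L = "reading_cells n w"
  have word: "map ?P ?L = [1..<Suc (perm_length n w)]"
    using super_yamanouchi_props(2)[OF assms] by (simp add: reverse_row_word_def)
  have nth: "?P (?L ! k) = Suc k" if "k < length ?L" for k
    using arg_cong[OF word, of "\<lambda>xs. xs ! k"] that length_reading_cells[OF assms]
    by (simp del: upt_Suc)
  have img: "?P ` rothe n w = {1..perm_length n w}"
    using arg_cong[OF word, of set] set_reading_cells[OF assms] by auto
  have "inj_on ?P (rothe n w)"
    using word distinct_map[of ?P ?L] set_reading_cells[OF assms] by (metis distinct_upt)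
  then have std: "standard_filling n w ?P"
    using img super_yamanouchi_props(1)[OF assms] by (auto simp: standard_filling_def bij_betw_def)
  have mono: "?P x < ?P y" if xy: "x \<in> rothe n w" "y \<in> rothe n w" "read_before x y" for x y
  proof -
    obtain k l where k: "k < length ?L" "x = ?L ! k" and l: "l < length ?L" "y = ?L ! l"
      using xy(1,2) set_reading_cells[OF assms] by (metis in_set_conv_nth)
    have "\<not> l \<le> k"
    proof
      assume "l \<le> k"
      then have "l = k \<or> read_before y x"
        using sorted_wrt_nth_less[OF sorted_reading_cells[of n w], of l k] k l by (metis le_neq_implies_less)
      then show False using xy(3) k l by (auto simp: read_before_def)
    qed
    then show ?thesis using nth k l by simp
  qed
  have "balanced n w ?P"
    unfolding balanced_def
  proof (clarify)
    fix r c assume rc: "(r, c) \<in> rothe n w"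
    have "{c'. (r, c') \<in> rothe n w \<and> c' > c \<and> ?P (r, c') > ?P (r, c)} = {}"
      using mono[OF _ rc] by (force simp: read_before_def)
    moreover have "{r'. (r', c) \<in> rothe n w \<and> r' > r \<and> ?P (r', c) < ?P (r, c)} = {}"
      using mono[OF rc] by (force simp: read_before_def)
    ultimately show "card {c'. (r, c') \<in> rothe n w \<and> c' > c \<and> ?P (r, c') > ?P (r, c)} =
      card {r'. (r', c) \<in> rothe n w \<and> r' > r \<and> ?P (r', c) < ?P (r, c)}" by (simp only:)
  qed
  with std show ?thesis by (simp add: SBT_def)
qed

end

theory Submission
  imports Defs
begin

text \<open>Every nontrivial Coxeter move changes the inversion number by exactly one and
  \<open>inv (P\<^sub>w) = 0\<close>, which gives the lower bound. The moves are involutions and preserve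
  balancedness, so for the upper bound it suffices that every \<open>R \<noteq> P\<^sub>w\<close> admits a move lowering the
  inversion number.

  If no \<open>c\<close>-move lowers it, an entry \<open>i\<close> that is higher than \<open>i + 1\<close> lies in the same column.
  For the largest such \<open>i\<close>, the entries from \<open>i + 1\<close> on are ordered by rows, and the local form of
  balancedness (\<open>hook_ordered\<close>) forces \<open>i + 2\<close> to be to the right of \<open>i + 1\<close> in its row, so that a
  \<open>b\<close>-move applies. If there is no such \<open>i\<close>, balancedness makes the rows decreasing and \<open>R = P\<^sub>w\<close>.

  That balancedness is equivalent to conditions on triples \<open>i < j < k\<close> goes back to Edelman and
  Greene. The direction needed here is by induction on the number of inversions: the largest entry
  sits at \<open>(p, w (p + 1))\<close> for a descent \<open>p\<close>, and deleting it while interchanging rows \<open>p\<close> and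
  \<open>p + 1\<close> leaves a balanced filling for \<open>w s\<^sub>p\<close>.\<close>

section \<open>The local form of balancedness\<close>

definition inversions :: "nat \<Rightarrow> (nat \<Rightarrow> nat) \<Rightarrow> (nat \<times> nat) set" where
  "inversions n w = {(i, j). 1 \<le> i \<and> i < j \<and> j \<le> n \<and> w i > w j}"

text \<open>Below, \<open>S i j\<close> is the entry of the cell \<open>(i, w j)\<close> of the Rothe diagram; it is only
  meaningful on inversions.\<close>

definition inversion_balanced :: "nat \<Rightarrow> (nat \<Rightarrow> nat) \<Rightarrow> (nat \<Rightarrow> nat \<Rightarrow> nat) \<Rightarrow> bool" where
  "inversion_balanced n w S \<longleftrightarrow> (\<forall>(i, k) \<in> inversions n w.
     card {j. i < j \<and> j \<le> n \<and> w k < w j \<and> w j < w i \<and> S i j > S i k} =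
     card {j. i < j \<and> j < k \<and> w j > w k \<and> S j k < S i k})"

text \<open>These are the constraints on three letters in a sequence of adjacent swaps that sorts
  the indices, listed by increasing value of \<open>w\<close>, into increasing order. A decreasing
  triple leaves two orders of its three inversions, with the corner \<open>(i, k)\<close> in the
  middle; the patterns 312 and 231 have two inversions each, in a forced order.\<close>

definition hook_ordered :: "nat \<Rightarrow> (nat \<Rightarrow> nat) \<Rightarrow> (nat \<Rightarrow> nat \<Rightarrow> nat) \<Rightarrow> bool" where
  "hook_ordered n w S \<longleftrightarrow> (\<forall>i j k. 1 \<le> i \<and> i < j \<and> j < k \<and> k \<le> n \<longrightarrow>
     (w i > w j \<and> w j > w k \<longrightarrow>
        S i j < S i k \<and> S i k < S j k \<or> S j k < S i k \<and> S i k < S i j) \<and>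
     (w i > w k \<and> w k > w j \<longrightarrow> S i k < S i j) \<and>
     (w j > w i \<and> w i > w k \<longrightarrow> S i k < S j k))"

lemma finite_inversions [simp]: "finite (inversions n w)"
  by (rule finite_subset[of _ "{..n} \<times> {..n}"]) (auto simp: inversions_def)

lemma in_inversions [simp]:
  "(i, j) \<in> inversions n w \<longleftrightarrow> 1 \<le> i \<and> i < j \<and> j \<le> n \<and> w i > w j"
  by (auto simp: inversions_def)

section \<open>The largest entry of a balanced filling and its removal\<close>

lemma inversion_balancedD:
  assumes "inversion_balanced n w S" "(i, k) \<in> inversions n w"
  shows "card {j. i < j \<and> j \<le> n \<and> w k < w j \<and> w j < w i \<and> S i j > S i k} =
     card {j. i < j \<and> j < k \<and> w j > w k \<and> S j k < S i k}"
  using assms unfolding inversion_balanced_def by blast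

text \<open>Nothing exceeds the largest entry, so its row count is zero and by balancedness no
  diagram cell stands above it. If \<open>q\<close> were not \<open>Suc p\<close>, then
  \<open>w (Suc p) < w q\<close>, and \<open>(p, Suc p)\<close> would be an inversion with nothing
  above it but with the largest entry to its right.\<close>

lemma max_inversion_adjacent:
  assumes inj: "inj_on w {1..n}" and bal: "inversion_balanced n w S"
    and pq: "(p, q) \<in> inversions n w"
    and max: "\<And>i j. (i, j) \<in> inversions n w \<Longrightarrow> (i, j) \<noteq> (p, q) \<Longrightarrow> S i j < S p q"
  shows "q = Suc p"
proof (rule ccontr)
  assume ne: "q \<noteq> Suc p"
  have "\<not> (p < j \<and> j \<le> n \<and> w q < w j \<and> w j < w p \<and> S p j > S p q)" for j
    using max[of p j] pq by (cases "j = q") auto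
  then have "{j. p < j \<and> j \<le> n \<and> w q < w j \<and> w j < w p \<and> S p j > S p q} = {}"
    by blast
  then have "card {j. p < j \<and> j < q \<and> w j > w q \<and> S j q < S p q} = 0"
    using inversion_balancedD[OF bal pq] by (simp only: card.empty)
  then have none: "\<not> (p < j \<and> j < q \<and> w j > w q)" for j
    using max[of j q] pq by auto
  have "w (Suc p) \<noteq> w q"
    using inj_onD[OF inj, of "Suc p" q] ne pq by auto
  then have wp: "w (Suc p) < w q" using none[of "Suc p"] pq ne by force
  then have inv: "(p, Suc p) \<in> inversions n w" using pq ne by auto
  have "{j. p < j \<and> j < Suc p \<and> w j > w (Suc p) \<and> S j (Suc p) < S p (Suc p)} = {}" by auto
  then have "card {j. p < j \<and> j \<le> n \<and> w (Suc p) < w j \<and> w j < w p \<and> S p j > S p (Suc p)} = 0"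
    using inversion_balancedD[OF bal inv] by (simp only: card.empty)
  moreover have "q \<in> {j. p < j \<and> j \<le> n \<and> w (Suc p) < w j \<and> w j < w p \<and> S p j > S p (Suc p)}"
    using pq wp max[OF inv] ne by auto
  ultimately show False by (auto simp: card_eq_0_iff)
qed

text \<open>The columns are treated from right to left. If row \<open>p\<close> held the smaller
  entry in the column of \<open>k\<close>, its column count would be at most that of row
  \<open>Suc p\<close>, while its row count would be strictly larger because of the largest entry.
  Balancedness equates the two counts in each row.\<close>

lemma max_inversion_rows:
  assumes inj: "inj_on w {1..n}" and bal: "inversion_balanced n w S"
    and inj_S: "inj_on (case_prod S) (inversions n w)"
    and p: "(p, Suc p) \<in> inversions n w"
    and max: "\<And>i j. (i, j) \<in> inversions n w \<Longrightarrow> (i, j) \<noteq> (p, Suc p) \<Longrightarrow> S i j < S p (Suc p)"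
    and k: "(Suc p, k) \<in> inversions n w"
  shows "S (Suc p) k < S p k"
  using k
proof (induction "w p - w k" arbitrary: k rule: less_induct)
  case less
  note k = less.prems
  have kp: "(p, k) \<in> inversions n w" using k p by auto
  show ?case
  proof (rule ccontr)
    assume "\<not> S (Suc p) k < S p k"
    moreover have "S (Suc p) k \<noteq> S p k"
      using inj_onD[OF inj_S, of "(Suc p, k)" "(p, k)"] k kp by auto
    ultimately have ba: "S p k < S (Suc p) k" by simp
    let ?Rp = "{j. p < j \<and> j \<le> n \<and> w k < w j \<and> w j < w p \<and> S p j > S p k}"
    let ?Rq = "{j. Suc p < j \<and> j \<le> n \<and> w k < w j \<and> w j < w (Suc p) \<and> S (Suc p) j > S (Suc p) k}"
    let ?Cp = "{j. p < j \<and> j < k \<and> w j > w k \<and> S j k < S p k}"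
    let ?Cq = "{j. Suc p < j \<and> j < k \<and> w j > w k \<and> S j k < S (Suc p) k}"
    have "?Cp \<subseteq> ?Cq"
    proof
      fix j assume "j \<in> ?Cp"
      then show "j \<in> ?Cq" using ba by (cases "j = Suc p") auto
    qed
    then have "card ?Cp \<le> card ?Cq" by (intro card_mono) auto
    moreover have "?Rq \<subset> ?Rp"
    proof
      show "?Rq \<subseteq> ?Rp"
      proof
        fix j assume j: "j \<in> ?Rq"
        then have "S (Suc p) j < S p j"
          using p k by (intro less.hyps) auto
        then show "j \<in> ?Rp" using j ba p by auto
      qed
      have "Suc p \<in> ?Rp" using p k max[OF kp] by auto
      moreover have "Suc p \<notin> ?Rq" by simp
      ultimately show "?Rq \<noteq> ?Rp" by blast
    qed
    then have "card ?Rq < card ?Rp" by (intro psubset_card_mono) auto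
    moreover have "card ?Rp = card ?Cp" "card ?Rq = card ?Cq"
      by (rule inversion_balancedD[OF bal kp], rule inversion_balancedD[OF bal k])
    ultimately show False by simp
  qed
qed

text \<open>Triples not containing both \<open>p\<close> and \<open>Suc p\<close> are carried over
  from the smaller filling by \<open>s\<close>. The others are decided by maximality, by
  \<open>max_inversion_rows\<close> and by one use of the induction hypothesis.\<close>

lemma hook_ordered_if_balanced:
  assumes "inj_on w {1..n}" "inj_on (case_prod S) (inversions n w)" "inversion_balanced n w S"
  shows "hook_ordered n w S"
  using assms
proof (induction "card (inversions n w)" arbitrary: w S rule: less_induct)
  case less
  note inj = less.prems(1) and inj_S = less.prems(2) and bal = less.prems(3)
  show ?case
  proof (cases "inversions n w = {}")
    case True
    then have "\<not> (1 \<le> i \<and> i < j \<and> j \<le> n \<and> w i > w j)" for i j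
      using in_inversions by blast
    then show ?thesis unfolding hook_ordered_def by (metis less_trans less_imp_le le_trans)
  next
    case False
    let ?V = "case_prod S ` inversions n w"
    have "Max ?V \<in> ?V" using False by (intro Max_in) auto
    then obtain p q where pq: "(p, q) \<in> inversions n w" and m: "Max ?V = S p q" by force
    have max: "S i j < S p q" if "(i, j) \<in> inversions n w" "(i, j) \<noteq> (p, q)" for i j
    proof -
      have "S i j \<le> S p q" unfolding m[symmetric] using that by (intro Max_ge) force+
      moreover have "S i j \<noteq> S p q" using inj_onD[OF inj_S _ that(1) pq] that(2) by auto
      ultimately show ?thesis by simp
    qed
    have q: "q = Suc p" by (rule max_inversion_adjacent[OF inj bal pq max])
    note p = pq[unfolded q] and max = max[unfolded q]
    have rows: "S (Suc p) k < S p k" if "(Suc p, k) \<in> inversions n w" for k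
      by (rule max_inversion_rows[OF inj bal inj_S p max that])
    define s where "s = transpose p (Suc p)"
    have ss [simp]: "s (s i) = i" for i by (simp add: s_def)
    have s_eq: "s p = Suc p" "s (Suc p) = p" by (auto simp: s_def)
    have s_other: "s i = i" if "i \<noteq> p" "i \<noteq> Suc p" for i using that by (simp add: s_def)
    have s_less: "s i < s j \<longleftrightarrow> i < j" if "(i, j) \<noteq> (p, Suc p)" "(i, j) \<noteq> (Suc p, p)" for i j
      using that unfolding s_def transpose_def by auto
    have s_range: "1 \<le> s i \<and> s i \<le> n \<longleftrightarrow> 1 \<le> i \<and> i \<le> n" for i
      using p unfolding s_def transpose_def by auto
    have s_inj: "s i = s j \<longleftrightarrow> i = j" for i j by (metis ss)
    \<comment> \<open>Interchanging the two positions removes exactly the inversion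
      \<open>(p, Suc p)\<close>; all other entries travel with their relabelled inversions.\<close>
    define w' where "w' = w \<circ> s"
    define S' where "S' i j = S (s i) (s j)" for i j
    have inv': "(i, j) \<in> inversions n w' \<longleftrightarrow> (s i, s j) \<in> inversions n w - {(p, Suc p)}" for i j
    proof (cases "w (s j) < w (s i) \<and> (s i, s j) \<noteq> (p, Suc p)")
      case True
      then have "(s i, s j) \<noteq> (Suc p, p)" using p by auto
      then have "i < j \<longleftrightarrow> s i < s j" using s_less[of "s i" "s j"] True by simp
      moreover have "1 \<le> i \<and> i \<le> n \<and> 1 \<le> j \<and> j \<le> n \<longleftrightarrow>
          1 \<le> s i \<and> s i \<le> n \<and> 1 \<le> s j \<and> s j \<le> n"
        using s_range[of i] s_range[of j] by blast
      ultimately show ?thesis using True by (auto simp: w'_def)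
    next
      case False
      moreover have "\<not> (i < j \<and> (s i, s j) = (p, Suc p))" using s_eq ss[of i] ss[of j] by auto
      ultimately show ?thesis by (auto simp: w'_def)
    qed
    have inv_img: "inversions n w' = map_prod s s ` (inversions n w - {(p, Suc p)})"
    proof (intro set_eqI iffI)
      fix x assume "x \<in> inversions n w'"
      then show "x \<in> map_prod s s ` (inversions n w - {(p, Suc p)})"
        using inv'[of "fst x" "snd x"]
        by (intro image_eqI[of _ _ "(s (fst x), s (snd x))"]) auto
    next
      fix x assume "x \<in> map_prod s s ` (inversions n w - {(p, Suc p)})"
      then show "x \<in> inversions n w'"
        using inv'[of "fst x" "snd x"] by (auto simp del: in_inversions)
    qed
    have "card (inversions n w') \<le> card (inversions n w - {(p, Suc p)})"
      unfolding inv_img by (intro card_image_le) simp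
    also have "\<dots> < card (inversions n w)"
      by (rule card_Diff1_less[OF finite_inversions p])
    finally have card_less: "card (inversions n w') < card (inversions n w)" .
    have inj': "inj_on w' {1..n}"
    proof (rule inj_onI)
      fix i j assume "i \<in> {1..n}" "j \<in> {1..n}" "w' i = w' j"
      then show "i = j"
        using inj_onD[OF inj, of "s i" "s j"] s_range[of i] s_range[of j] s_inj by (simp add: w'_def)
    qed
    have inj_S': "inj_on (case_prod S') (inversions n w')"
    proof (rule inj_onI)
      fix x y assume "x \<in> inversions n w'" "y \<in> inversions n w'" "case_prod S' x = case_prod S' y"
      then have "(s (fst x), s (snd x)) = (s (fst y), s (snd y))"
        using inv'[of "fst x" "snd x"] inv'[of "fst y" "snd y"]
        by (intro inj_onD[OF inj_S]) (auto simp: S'_def case_prod_beta simp del: in_inversions)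
      then show "x = y" using s_inj by (simp add: prod_eq_iff)
    qed
    have bal': "inversion_balanced n w' S'"
      unfolding inversion_balanced_def
    proof (clarify)
      fix i' k' assume ik': "(i', k') \<in> inversions n w'"
      define i k where "i = s i'" and "k = s k'"
      have i': "i' = s i" "k' = s k" by (auto simp: i_def k_def)
      have ik: "(i, k) \<in> inversions n w" "(i, k) \<noteq> (p, Suc p)"
        using ik' inv' by (auto simp: i_def k_def simp del: in_inversions)
      let ?R = "{j. i < j \<and> j \<le> n \<and> w k < w j \<and> w j < w i \<and> S i j > S i k}"
      let ?C = "{j. i < j \<and> j < k \<and> w j > w k \<and> S j k < S i k}"
      \<comment> \<open>Both counts for \<open>w'\<close> are pulled back along \<open>s\<close>, so
        that they differ from the counts for \<open>w\<close> only in comparisons of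
        \<open>p\<close> with \<open>Suc p\<close>.\<close>
      let ?R' = "{j. s i < s j \<and> s j \<le> n \<and> w k < w j \<and> w j < w i \<and> S i j > S i k}"
      let ?C' = "{j. s i < s j \<and> s j < s k \<and> w j > w k \<and> S j k < S i k}"
      have "{j. i' < j \<and> j \<le> n \<and> w' k' < w' j \<and> w' j < w' i' \<and> S' i' j > S' i' k'} = s ` ?R'"
        unfolding i' w'_def S'_def by (auto simp: image_iff) (metis ss)
      then have R': "card {j. i' < j \<and> j \<le> n \<and> w' k' < w' j \<and> w' j < w' i' \<and> S' i' j > S' i' k'} = card ?R'"
        by (simp add: card_image inj_on_def s_inj)
      have "{j. i' < j \<and> j < k' \<and> w' j > w' k' \<and> S' j k' < S' i' k'} = s ` ?C'"
        unfolding i' w'_def S'_def by (auto simp: image_iff) (metis ss)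
      then have C': "card {j. i' < j \<and> j < k' \<and> w' j > w' k' \<and> S' j k' < S' i' k'} = card ?C'"
        by (simp add: card_image inj_on_def s_inj)
      have RC: "card ?R = card ?C" by (rule inversion_balancedD[OF bal ik(1)])
      have rng: "s j \<le> n \<longleftrightarrow> j \<le> n" for j
        using p by (auto simp: s_def transpose_def)
      have "card ?R' = card ?C'"
      \<comment> \<open>Only in row \<open>p\<close>, to the left of the deleted cell, do the counts
        change. There \<open>Suc p\<close> leaves the row count as the deleted entry, and leaves the
        column count because row \<open>Suc p\<close>, with the smaller entry, is now below.\<close>
      proof (cases "i = p \<and> w k < w (Suc p)")
        case True
        then have k: "(Suc p, k) \<in> inversions n w" using ik by auto
        have mem: "Suc p \<in> ?R" "Suc p \<in> ?C"
          using True k p rows[OF k] max[OF ik] by auto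
        have sp: "s p < s j \<longleftrightarrow> p < j \<and> j \<noteq> Suc p" for j
          using s_less[of p j] by (cases "j = Suc p") (simp_all add: s_eq)
        have sk: "s j < s k \<longleftrightarrow> j < k" for j
          using k by (intro s_less) auto
        have "?R' = ?R - {Suc p}" unfolding rng using True sp by auto
        moreover have "?C' = ?C - {Suc p}" using True sp sk by auto
        ultimately show ?thesis using mem RC by simp
      next
        case False
        have "s i < s j \<longleftrightarrow> i < j" if "w k < w j" "w j < w i" for j
          using that False p by (intro s_less) auto
        then have "?R' = ?R" unfolding rng by blast
        moreover have "s i < s j \<and> s j < s k \<longleftrightarrow> i < j \<and> j < k" if "w k < w j" "S j k < S i k" for j
        proof -
          have 1: "(i, j) \<noteq> (p, Suc p)" using False that by auto
          have 2: "(i, j) \<noteq> (Suc p, p)"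
          proof
            \<comment> \<open>The interchange does bring row \<open>p\<close> above row
              \<open>Suc p\<close>, but its entry in the column of \<open>k\<close> is larger and so
              is not counted.\<close>
            assume "(i, j) = (Suc p, p)"
            then show False using rows[of k] ik(1) that(2) by force
          qed
          have 3: "(j, k) \<noteq> (p, Suc p)" using max[OF ik] that by auto
          have 4: "(j, k) \<noteq> (Suc p, p)" using p that by auto
          show ?thesis using s_less[OF 1 2] s_less[OF 3 4] by simp
        qed
        then have "?C' = ?C" by blast
        ultimately show ?thesis using RC by simp
      qed
      then show "card {j. i' < j \<and> j \<le> n \<and> w' k' < w' j \<and> w' j < w' i' \<and> S' i' j > S' i' k'} =
        card {j. i' < j \<and> j < k' \<and> w' j > w' k' \<and> S' j k' < S' i' k'}"
        using R' C' by simp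
    qed
    have ho': "hook_ordered n w' S'"
      by (rule less.hyps[OF card_less inj' inj_S' bal'])
    show ?thesis
      unfolding hook_ordered_def
    proof (intro allI impI)
      fix i j k assume ijk: "1 \<le> i \<and> i < j \<and> j < k \<and> k \<le> n"
      let ?G = "(w i > w j \<and> w j > w k \<longrightarrow>
          S i j < S i k \<and> S i k < S j k \<or> S j k < S i k \<and> S i k < S i j) \<and>
        (w i > w k \<and> w k > w j \<longrightarrow> S i k < S i j) \<and>
        (w j > w i \<and> w i > w k \<longrightarrow> S i k < S j k)"
      consider "(i, j) = (p, Suc p)" | "(j, k) = (p, Suc p)"
        | "(i, j) \<noteq> (p, Suc p)" "(j, k) \<noteq> (p, Suc p)" by blast
      then show ?G
      proof cases
        case 1
        then show ?thesis using ijk p max[of i k] rows[of k] by auto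
      next
        case 2
        \<comment> \<open>Maximality does not settle this one. In \<open>w'\<close> the triple
          \<open>i\<close>, \<open>p\<close>, \<open>Suc p\<close> has pattern 312, so the induction
          hypothesis orders its two entries.\<close>
        have "S i p < S i (Suc p)" if "w i > w p"
        proof -
          have "i < p" using ijk 2 by auto
          then have "S' i (Suc p) < S' i p"
            using ho'[unfolded hook_ordered_def, rule_format, of i p "Suc p"] that p ijk 2
            by (auto simp: w'_def s_eq s_other)
          then show ?thesis using \<open>i < p\<close> by (simp add: S'_def s_eq s_other)
        qed
        then show ?thesis using 2 ijk p max[of i k] by auto
      next
        case 3
        then have "s i < s j" "s j < s k" using s_less[of i j] s_less[of j k] ijk by auto
        moreover have "1 \<le> s i" "s k \<le> n" using s_range[of i] s_range[of k] ijk by auto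
        ultimately show ?thesis
          using ho'[unfolded hook_ordered_def, rule_format, of "s i" "s j" "s k"]
          by (simp add: w'_def S'_def)
      qed
    qed
  qed
qed

text \<open>Read the entries as the times of adjacent swaps sorting a word, the entry of \<open>(i, w j)\<close> being
  the time at which \<open>i\<close> passes \<open>j\<close>. If \<open>q\<close> meets \<open>b\<close> and then at once \<open>a < b\<close>, then afterwards
  \<open>b\<close> and \<open>a\<close> are neighbours, so \<open>b\<close> is the only letter that \<open>a\<close> can pass next.\<close>

lemma hook_ordered_next:
  assumes ho: "hook_ordered n w S" and winj: "inj_on w {1..n}"
    and inj: "inj_on (case_prod S) (inversions n w)"
    and inv: "(a, b) \<in> inversions n w" "(b, q) \<in> inversions n w" "(a, d) \<in> inversions n w"
    and S: "S b q = i" "S a q = Suc i" "S a d = Suc (Suc i)" "S a b > Suc i"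
  shows "d = b"
proof (rule ccontr)
  assume db: "d \<noteq> b"
  have H: "(w x > w y \<and> w y > w z \<longrightarrow> S x y < S x z \<and> S x z < S y z \<or> S y z < S x z \<and> S x z < S x y) \<and>
     (w x > w z \<and> w z > w y \<longrightarrow> S x z < S x y) \<and> (w y > w x \<and> w x > w z \<longrightarrow> S x z < S y z)"
    if "1 \<le> x" "x < y" "y < z" "z \<le> n" for x y z
    using ho that unfolding hook_ordered_def by blast
  have W: "w x \<noteq> w y" if "x \<in> {1..n}" "y \<in> {1..n}" "x \<noteq> y" for x y
    using inj_onD[OF winj] that by blast
  have rng: "1 \<le> a" "a < b" "b < q" "a < d" "q \<le> n" "d \<le> n" "w a > w b" "w b > w q" "w a > w d"
    using inv by auto
  have dq: "d \<noteq> q" using S by auto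
  have wd: "w d \<noteq> w b" "w d \<noteq> w q" using W[of d b] W[of d q] rng db dq by auto
  have Sne: "S x y \<noteq> S x' y'"
    if "(x, y) \<in> inversions n w" "(x', y') \<in> inversions n w" "(x, y) \<noteq> (x', y')" for x y x' y'
    using inj_onD[OF inj _ that(1,2)] that(3) by auto
  have Sab: "S a b > Suc (Suc i)" using Sne[of a b a d] inv db S by auto
  \<comment> \<open>Most branches squeeze \<open>S b d\<close> strictly between \<open>i\<close> and
    \<open>i + 2\<close>, where the only value \<open>i + 1\<close> belongs to
    \<open>(a, q)\<close>. If \<open>d < b\<close>, it is \<open>S d q\<close> that cannot be
    placed.\<close>
  consider "d < b" | "b < d" "d < q" | "q < d" using db dq by linarith
  then show False
  proof cases
    case 1
    have "w d > w b" using H[of a d b] rng 1 wd S Sab by auto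
    then have "S d b > S a b" using H[of a d b] rng 1 S Sab by auto
    then have "S d q > i" using H[of d b q] rng 1 S Sab \<open>w d > w b\<close> by auto
    moreover have "S d q \<noteq> Suc i" using Sne[of d q a q] rng 1 S \<open>w d > w b\<close> by auto
    ultimately show False using H[of a d q] rng 1 S \<open>w d > w b\<close> by auto
  next
    case 2
    show False
    proof (cases "w d > w q")
      case True
      then have "S d q < Suc i" using H[of a d q] rng 2 S by auto
      moreover have "S d q \<noteq> i" using Sne[of d q b q] rng 2 S True by auto
      ultimately have dq_i: "S d q < i" by simp
      show False
      proof (cases "w d > w b")
        case True
        then show False using H[of b d q] rng 2 S dq_i by auto
      next
        case False
        then have "w d < w b" using wd by auto
        then show False using H[of b d q] H[of a b d] rng 2 S Sab dq_i True Sne[of b d a q] by auto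
      qed
    next
      case False
      then have "w d < w q" using wd by auto
      then show False using H[of b d q] H[of a b d] rng 2 S Sab Sne[of b d a q] by auto
    qed
  next
    case 3
    have "w d < w q" using H[of a q d] rng 3 S wd by auto
    then show False
      using H[of a q d] H[of a b d] H[of b q d] rng 3 S Sab Sne[of b d a q] by auto
  qed
qed

section \<open>Standard fillings\<close>

lemma standard_fillingD:
  assumes "standard_filling n w T"
  shows "inj_on T (rothe n w)" "T ` rothe n w = {1..perm_length n w}"
    "\<And>c. c \<notin> rothe n w \<Longrightarrow> T c = 0"
  using assms by (auto simp: standard_filling_def bij_betw_def)

lemma standard_filling_range:
  assumes "standard_filling n w T" "x \<in> rothe n w"
  shows "1 \<le> T x" "T x \<le> perm_length n w"
  using assms standard_fillingD(2)[of n w T] by auto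

lemma cell_of_entry:
  assumes "standard_filling n w T" "x \<in> rothe n w"
  shows "cell_of n w T (T x) = x"
  unfolding cell_of_def using assms standard_fillingD(1) by (metis inv_into_f_f)

lemma cell_of_in:
  assumes "standard_filling n w T" "1 \<le> k" "k \<le> perm_length n w"
  shows "cell_of n w T k \<in> rothe n w" "T (cell_of n w T k) = k"
proof -
  have "k \<in> T ` rothe n w" using assms standard_fillingD(2) by (metis atLeastAtMost_iff)
  then show "cell_of n w T k \<in> rothe n w" "T (cell_of n w T k) = k"
    unfolding cell_of_def by (rule inv_into_into, rule f_inv_into_f)
qed

lemma in_rothe_iff:
  assumes "w permutes {1..n}"
  shows "(i, w j) \<in> rothe n w \<longleftrightarrow> (i, j) \<in> inversions n w"
  using injD[OF permutes_inj[OF assms]] by (auto simp: rothe_def)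

lemma standard_filling_inj_on_inversions:
  assumes w: "w permutes {1..n}" and T: "standard_filling n w T"
  shows "inj_on (\<lambda>(i, j). T (i, w j)) (inversions n w)"
proof (rule inj_onI, clarify)
  fix i j k l
  assume "(i, j) \<in> inversions n w" "(k, l) \<in> inversions n w" "T (i, w j) = T (k, w l)"
  then have "(i, w j) = (k, w l)"
    using inj_onD[OF standard_fillingD(1)[OF T]] in_rothe_iff[OF w] by blast
  then show "i = k \<and> j = l" using injD[OF permutes_inj[OF w]] by simp
qed

lemma balancedD:
  assumes "balanced n w T" "(r, c) \<in> rothe n w"
  shows "card {c'. (r, c') \<in> rothe n w \<and> c' > c \<and> T (r, c') > T (r, c)} =
     card {r'. (r', c) \<in> rothe n w \<and> r' > r \<and> T (r', c) < T (r, c)}"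
  using assms unfolding balanced_def by blast

text \<open>Transfers the result from pairs of indices to cells. Cells in a row are named by
  columns, that is by values of \<open>w\<close>, so the row count passes through the image under
  \<open>w\<close>; cells in a column are named by rows, which are indices already.\<close>

lemma SBT_hook_ordered:
  assumes w: "w permutes {1..n}" and R: "R \<in> SBT n w"
  shows "hook_ordered n w (\<lambda>i j. R (i, w j))"
proof (rule hook_ordered_if_balanced)
  have winj: "w a = w b \<longleftrightarrow> a = b" for a b using permutes_inj[OF w] by (auto dest: injD)
  have std: "standard_filling n w R" and bal: "balanced n w R" using R by (auto simp: SBT_def)
  show "inj_on w {1..n}" using winj by (simp add: inj_on_def)
  show "inj_on (\<lambda>(i, j). R (i, w j)) (inversions n w)"
    by (rule standard_filling_inj_on_inversions[OF w std])
  show "inversion_balanced n w (\<lambda>i j. R (i, w j))"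
    unfolding inversion_balanced_def
  proof (clarify)
    fix i k assume ik: "(i, k) \<in> inversions n w"
    have "{c'. (i, c') \<in> rothe n w \<and> c' > w k \<and> R (i, c') > R (i, w k)} =
        w ` {j. i < j \<and> j \<le> n \<and> w k < w j \<and> w j < w i \<and> R (i, w j) > R (i, w k)}"
      using ik by (auto simp: rothe_def)
    then have "card {c'. (i, c') \<in> rothe n w \<and> c' > w k \<and> R (i, c') > R (i, w k)} =
        card {j. i < j \<and> j \<le> n \<and> w k < w j \<and> w j < w i \<and> R (i, w j) > R (i, w k)}"
      using winj by (simp add: card_image inj_on_def)
    moreover have "{r'. (r', w k) \<in> rothe n w \<and> r' > i \<and> R (r', w k) < R (i, w k)} =
        {j. i < j \<and> j < k \<and> w j > w k \<and> R (j, w k) < R (i, w k)}"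
      using ik by (auto simp: in_rothe_iff[OF w])
    moreover have "(i, w k) \<in> rothe n w" using ik in_rothe_iff[OF w] by blast
    then have "card {c'. (i, c') \<in> rothe n w \<and> c' > w k \<and> R (i, c') > R (i, w k)} =
        card {r'. (r', w k) \<in> rothe n w \<and> r' > i \<and> R (r', w k) < R (i, w k)}"
      by (rule balancedD[OF bal])
    ultimately show "card {j. i < j \<and> j \<le> n \<and> w k < w j \<and> w j < w i \<and> R (i, w j) > R (i, w k)} =
        card {j. i < j \<and> j < k \<and> w j > w k \<and> R (j, w k) < R (i, w k)}"
      by simp
  qed
qed

section \<open>Exchanging two entries\<close>

text \<open>The inversions are recorded by cells instead of entries, since an exchange moves the
  entries and leaves the cells in place.\<close>

definition cell_inversions :: "nat \<Rightarrow> (nat \<Rightarrow> nat) \<Rightarrow> filling \<Rightarrow> (cell \<times> cell) set" where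
  "cell_inversions n w T = {(x, y). x \<in> rothe n w \<and> y \<in> rothe n w \<and> T x < T y \<and>
     fst x > fst y \<and> snd x \<noteq> snd y}"

lemma inv_number_eq:
  assumes T: "standard_filling n w T"
  shows "inv_number n w T = card (cell_inversions n w T)"
proof -
  let ?I = "{(i, j). 1 \<le> i \<and> i < j \<and> j \<le> perm_length n w \<and>
     row_of n w T i > row_of n w T j \<and> col_of n w T i \<noteq> col_of n w T j}"
  have "bij_betw (map_prod T T) (cell_inversions n w T) ?I"
  proof (rule bij_betwI[where g = "map_prod (cell_of n w T) (cell_of n w T)"])
    show "map_prod T T \<in> cell_inversions n w T \<rightarrow> ?I"
      using standard_filling_range[OF T]
      by (auto simp: cell_inversions_def row_of_def col_of_def cell_of_entry[OF T])
    show "map_prod (cell_of n w T) (cell_of n w T) \<in> ?I \<rightarrow> cell_inversions n w T"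
    proof (rule funcsetI, clarify)
      fix i j assume "1 \<le> i" "i < j" "j \<le> perm_length n w"
        "row_of n w T j < row_of n w T i" "col_of n w T i \<noteq> col_of n w T j"
      then show "map_prod (cell_of n w T) (cell_of n w T) (i, j) \<in> cell_inversions n w T"
        using cell_of_in[OF T, of i] cell_of_in[OF T, of j]
        by (simp add: cell_inversions_def row_of_def col_of_def)
    qed
    show "map_prod (cell_of n w T) (cell_of n w T) (map_prod T T x) = x"
      if "x \<in> cell_inversions n w T" for x
      using that by (auto simp: cell_inversions_def cell_of_entry[OF T])
    show "map_prod T T (map_prod (cell_of n w T) (cell_of n w T) y) = y" if "y \<in> ?I" for y
      using that cell_of_in[OF T] by auto
  qed
  then show ?thesis unfolding inv_number_def by (simp add: bij_betw_same_card)
qed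

text \<open>The common shape of the Coxeter moves: a cell whose entry lies strictly between the exchanged
  ones must be the lower left corner of the rectangle having \<open>u\<close> and \<open>v\<close> as its other diagonal.
  For a c-move there is no such cell.\<close>

definition exchangeable :: "nat \<Rightarrow> (nat \<Rightarrow> nat) \<Rightarrow> filling \<Rightarrow> cell \<Rightarrow> cell \<Rightarrow> bool" where
  "exchangeable n w T u v \<longleftrightarrow> u \<in> rothe n w \<and> v \<in> rothe n w \<and> T u < T v \<and>
     fst u \<noteq> fst v \<and> snd u \<noteq> snd v \<and>
     (\<forall>z \<in> rothe n w. T u < T z \<and> T z < T v \<longrightarrow>
        (snd u < snd v \<longleftrightarrow> fst v < fst u) \<and> z = (min (fst u) (fst v), min (snd u) (snd v)))"

definition exchange :: "filling \<Rightarrow> cell \<Rightarrow> cell \<Rightarrow> filling" where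
  "exchange T u v = transpose (T u) (T v) \<circ> T"

text \<open>Trading \<open>a\<close> and \<open>b\<close> changes their order only relative to each
  other and to values strictly between them.\<close>

lemma transpose_less_iff:
  fixes a b c d :: "'a::linorder"
  assumes "a < b" "{c, d} \<noteq> {a, b}"
    and "\<not> (c \<in> {a, b} \<and> a < d \<and> d < b)" "\<not> (d \<in> {a, b} \<and> a < c \<and> c < b)"
  shows "transpose a b c < transpose a b d \<longleftrightarrow> c < d"
  using assms by (auto simp: transpose_def)

lemma exchange_less_iff:
  assumes T: "standard_filling n w T" and uv: "exchangeable n w T u v"
    and xy: "x \<in> rothe n w" "y \<in> rothe n w" "{x, y} \<noteq> {u, v}"
    and "\<not> (x \<in> {u, v} \<and> T u < T y \<and> T y < T v)" "\<not> (y \<in> {u, v} \<and> T u < T x \<and> T x < T v)"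
  shows "exchange T u v x < exchange T u v y \<longleftrightarrow> T x < T y"
proof -
  have inj: "T a = T b \<longleftrightarrow> a = b" if "a \<in> rothe n w" "b \<in> rothe n w" for a b
    using inj_onD[OF standard_fillingD(1)[OF T]] that by blast
  have "u \<in> rothe n w" "v \<in> rothe n w" "T u < T v" using uv by (auto simp: exchangeable_def)
  then show ?thesis
    unfolding exchange_def comp_apply using assms inj
    by (intro transpose_less_iff) (auto simp: doubleton_eq_iff)
qed

lemma exchange_standard:
  assumes T: "standard_filling n w T" and "u \<in> rothe n w" "v \<in> rothe n w"
  shows "standard_filling n w (exchange T u v)"
proof -
  note uv = standard_filling_range[OF T assms(2)] standard_filling_range[OF T assms(3)]
  have "bij_betw (transpose (T u) (T v)) {1..perm_length n w} {1..perm_length n w}"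
    by (rule permutes_imp_bij, rule permutes_swap_id) (use uv in auto)
  then have "bij_betw (exchange T u v) (rothe n w) {1..perm_length n w}"
    using T unfolding exchange_def standard_filling_def by (blast intro: bij_betw_trans)
  \<comment> \<open>Entries are at least 1, so the transposition fixes the default value 0.\<close>
  moreover have "exchange T u v c = 0" if "c \<notin> rothe n w" for c
    using uv standard_fillingD(3)[OF T that] by (auto simp: exchange_def transpose_def)
  ultimately show ?thesis by (simp add: standard_filling_def)
qed

lemma exchange_uv: "exchange T u v u = T v" "exchange T u v v = T u"
  by (auto simp: exchange_def)

lemma exchange_between:
  assumes "T u < T x" "T x < T v"
  shows "exchange T u v x = T x"
  using assms by (auto simp: exchange_def)

text \<open>A cell whose entry lies between the exchanged ones shares a row or a column with each of
  \<open>u\<close> and \<open>v\<close>, so it never forms a counted pair with them. Hence only the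
  pair of \<open>u\<close> and \<open>v\<close> itself can change.\<close>

lemma cell_inversions_exchange:
  assumes T: "standard_filling n w T" and uv: "exchangeable n w T u v"
  shows "cell_inversions n w (exchange T u v) =
    (if fst v < fst u then cell_inversions n w T - {(u, v)} else insert (v, u) (cell_inversions n w T))"
proof -
  have iff: "exchange T u v x < exchange T u v y \<longleftrightarrow> T x < T y"
    if "x \<in> rothe n w" "y \<in> rothe n w" "fst x \<noteq> fst y" "snd x \<noteq> snd y" "{x, y} \<noteq> {u, v}" for x y
  proof (rule exchange_less_iff[OF T uv])
    have "\<not> (a \<in> {u, v} \<and> T u < T b \<and> T b < T v)"
      if "b \<in> rothe n w" "fst a \<noteq> fst b" "snd a \<noteq> snd b" for a b
    proof
      assume *: "a \<in> {u, v} \<and> T u < T b \<and> T b < T v"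
      then have "(snd u < snd v \<longleftrightarrow> fst v < fst u) \<and> b = (min (fst u) (fst v), min (snd u) (snd v))"
        using uv that(1) unfolding exchangeable_def by blast
      then show False using * that(2,3) uv by (auto simp: exchangeable_def min_def split: if_splits)
    qed
    then show "\<not> (x \<in> {u, v} \<and> T u < T y \<and> T y < T v)" "\<not> (y \<in> {u, v} \<and> T u < T x \<and> T x < T v)"
      using that by metis+
  qed (use that in auto)
  have *: "u \<in> rothe n w" "v \<in> rothe n w" "T u < T v" "fst u \<noteq> fst v" "snd u \<noteq> snd v"
    using uv by (auto simp: exchangeable_def)
  have "(x, y) \<in> cell_inversions n w (exchange T u v) \<longleftrightarrow>
    (if fst v < fst u then (x, y) \<in> cell_inversions n w T - {(u, v)}
     else (x, y) \<in> insert (v, u) (cell_inversions n w T))" for x y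
  proof (cases "{x, y} = {u, v}")
    case True
    then show ?thesis using * by (auto simp: cell_inversions_def doubleton_eq_iff exchange_uv)
  next
    case False
    then show ?thesis using iff[of x y] by (auto simp: cell_inversions_def doubleton_eq_iff)
  qed
  then show ?thesis by auto
qed

lemma finite_rothe:
  assumes "w permutes {1..n}" shows "finite (rothe n w)"
  using rothe_subset[OF assms] by (rule finite_subset) simp

lemma finite_cell_inversions:
  assumes "w permutes {1..n}" shows "finite (cell_inversions n w T)"
  by (rule finite_subset[of _ "rothe n w \<times> rothe n w"])
    (auto simp: cell_inversions_def finite_rothe[OF assms])

text \<open>The equality serves the descent from \<open>R\<close>, the inequality the bound on
  arbitrary sequences of moves.\<close>

lemma inv_number_exchange:
  assumes w: "w permutes {1..n}" and T: "standard_filling n w T" and uv: "exchangeable n w T u v"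
  shows "fst v < fst u \<Longrightarrow> inv_number n w T = Suc (inv_number n w (exchange T u v))"
    and "inv_number n w (exchange T u v) \<le> Suc (inv_number n w T)"
proof -
  have "u \<in> rothe n w" "v \<in> rothe n w" using uv by (auto simp: exchangeable_def)
  note T' = exchange_standard[OF T this]
  note eq = inv_number_eq[OF T] inv_number_eq[OF T'] cell_inversions_exchange[OF T uv]
  have "(u, v) \<in> cell_inversions n w T" if "fst v < fst u"
    using that uv by (auto simp: cell_inversions_def exchangeable_def)
  then show "fst v < fst u \<Longrightarrow> inv_number n w T = Suc (inv_number n w (exchange T u v))"
    by (simp add: eq card_Suc_Diff1 finite_cell_inversions[OF w] del: card_Diff_insert)
  show "inv_number n w (exchange T u v) \<le> Suc (inv_number n w T)"
    using card_mono[OF finite_cell_inversions[OF w], of "cell_inversions n w T - {(u, v)}" T]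
    by (auto simp: eq card_insert_if finite_cell_inversions[OF w])
qed

text \<open>The counts can change only at the corner cell. There one of \<open>u\<close>,
  \<open>v\<close> lies above and the other to the right, and the exchange either removes both from
  the counts or adds both.\<close>

lemma exchange_balanced:
  assumes w: "w permutes {1..n}" and T: "standard_filling n w T" and uv: "exchangeable n w T u v"
    and bal: "balanced n w T"
  shows "balanced n w (exchange T u v)"
  unfolding balanced_def
proof (clarify)
  fix r c assume rc: "(r, c) \<in> rothe n w"
  let ?D = "rothe n w" and ?T = "exchange T u v"
  let ?R = "\<lambda>T. {c'. (r, c') \<in> ?D \<and> c' > c \<and> T (r, c') > T (r, c)}"
  let ?C = "\<lambda>T. {r'. (r', c) \<in> ?D \<and> r' > r \<and> T (r', c) < T (r, c)}"
  have eq: "card (?R T) = card (?C T)" by (rule balancedD[OF bal rc])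
  have inD: "u \<in> ?D" "v \<in> ?D" and less: "T u < T v" and ne: "fst u \<noteq> fst v" "snd u \<noteq> snd v"
    using uv by (auto simp: exchangeable_def)
  have mid: "(snd u < snd v \<longleftrightarrow> fst v < fst u) \<and> z = (min (fst u) (fst v), min (snd u) (snd v))"
    if "z \<in> ?D" "T u < T z" "T z < T v" for z
    using uv that unfolding exchangeable_def by blast
  have fin: "finite (?R S)" "finite (?C S)" for S :: filling
    using finite_subset[OF _ finite_imageI[OF finite_rothe[OF w], of snd], of "?R S"]
      finite_subset[OF _ finite_imageI[OF finite_rothe[OF w], of fst], of "?C S"]
    by force+
  have "card (?R ?T) = card (?C ?T)"
  \<comment> \<open>If the entry of \<open>(r, c)\<close> is not in between, an order could change
    only when \<open>(r, c)\<close> is \<open>u\<close> or \<open>v\<close>. The cells with entries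
    in between then lie weakly below and to the left, outside the counted parts of row and
    column.\<close>
  proof (cases "T u < T (r, c) \<and> T (r, c) < T v")
    case False
    have R: "?T (r, c) < ?T (r, c') \<longleftrightarrow> T (r, c) < T (r, c')" if "(r, c') \<in> ?D" "c' > c" for c'
    proof (rule exchange_less_iff[OF T uv])
      show "\<not> ((r, c) \<in> {u, v} \<and> T u < T (r, c') \<and> T (r, c') < T v)"
      proof
        assume *: "(r, c) \<in> {u, v} \<and> T u < T (r, c') \<and> T (r, c') < T v"
        then have "c' = min (snd u) (snd v)" using mid[OF that(1)] by simp
        then show False using * that(2) by auto
      qed
    qed (use False ne that rc in \<open>auto simp: doubleton_eq_iff\<close>)
    have C: "?T (r', c) < ?T (r, c) \<longleftrightarrow> T (r', c) < T (r, c)" if "(r', c) \<in> ?D" "r' > r" for r'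
    proof (rule exchange_less_iff[OF T uv])
      show "\<not> ((r, c) \<in> {u, v} \<and> T u < T (r', c) \<and> T (r', c) < T v)"
      proof
        assume *: "(r, c) \<in> {u, v} \<and> T u < T (r', c) \<and> T (r', c) < T v"
        then have "r' = min (fst u) (fst v)" using mid[OF that(1)] by simp
        then show False using * that(2) by auto
      qed
    qed (use False ne that rc in \<open>auto simp: doubleton_eq_iff\<close>)
    have "?R ?T = ?R T" "?C ?T = ?C T" using R C by blast+
    then show ?thesis using eq by (simp only:)
  next
    case True
    note corner = mid[OF rc] and keep = exchange_between[of T u "(r, c)" v]
    have R: "?T (r, c) < ?T (r, c') \<longleftrightarrow> T (r, c) < T (r, c')"
      if "(r, c') \<in> ?D" "(r, c') \<notin> {u, v}" for c'
      by (rule exchange_less_iff[OF T uv]) (use True that rc in \<open>auto simp: doubleton_eq_iff\<close>)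
    have C: "?T (r', c) < ?T (r, c) \<longleftrightarrow> T (r', c) < T (r, c)"
      if "(r', c) \<in> ?D" "(r', c) \<notin> {u, v}" for r'
      by (rule exchange_less_iff[OF T uv]) (use True that rc in \<open>auto simp: doubleton_eq_iff\<close>)
    show ?thesis
    proof (cases "fst v < fst u")
      \<comment> \<open>Here \<open>u\<close> is above with a smaller entry and \<open>v\<close> to
        the right with a larger one: both are counted before the exchange, neither after.\<close>
      case v: True
      then have "snd u < snd v" "r = fst v" "c = snd u" using corner True by auto
      then obtain r1 c1 where uv': "u = (r1, c)" "v = (r, c1)" "r1 > r" "c1 > c"
        using v by (cases u; cases v) auto
      have val: "?T (r, c) = T (r, c)" "?T (r1, c) = T v" "?T (r, c1) = T u"
        using keep True uv' exchange_uv[of T u v] by auto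
      have 1: "c1 \<notin> ?R ?T" "r1 \<notin> ?C ?T" using val True by auto
      have "?R T = insert c1 (?R ?T)"
      proof (intro set_eqI)
        fix c' show "c' \<in> ?R T \<longleftrightarrow> c' \<in> insert c1 (?R ?T)"
          using R[of c'] True inD uv' by (cases "c' = c1") auto
      qed
      moreover have "?C T = insert r1 (?C ?T)"
      proof (intro set_eqI)
        fix r' show "r' \<in> ?C T \<longleftrightarrow> r' \<in> insert r1 (?C ?T)"
          using C[of r'] True inD uv' by (cases "r' = r1") auto
      qed
      ultimately show ?thesis using eq 1 fin[of ?T] by simp
    next
      \<comment> \<open>Here \<open>v\<close> is above and \<open>u\<close> to the right: neither is
        counted before the exchange, both are after.\<close>
      case v: False
      then have "snd v < snd u" "r = fst u" "c = snd v" using corner True ne by auto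
      then obtain r1 c1 where uv': "v = (r1, c)" "u = (r, c1)" "r1 > r" "c1 > c"
        using v ne by (cases u; cases v) auto
      have val: "?T (r, c) = T (r, c)" "?T (r1, c) = T u" "?T (r, c1) = T v"
        using keep True uv' exchange_uv[of T u v] by auto
      have 1: "c1 \<notin> ?R T" "r1 \<notin> ?C T" using uv' True by auto
      have "?R ?T = insert c1 (?R T)"
      proof (intro set_eqI)
        fix c' show "c' \<in> ?R ?T \<longleftrightarrow> c' \<in> insert c1 (?R T)"
          using R[of c'] True inD uv' val by (cases "c' = c1") auto
      qed
      moreover have "?C ?T = insert r1 (?C T)"
      proof (intro set_eqI)
        fix r' show "r' \<in> ?C ?T \<longleftrightarrow> r' \<in> insert r1 (?C T)"
          using C[of r'] True inD uv' val by (cases "r' = r1") auto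
      qed
      ultimately show ?thesis using eq 1 fin[of T] by simp
    qed
  qed
  then show "card {c'. (r, c') \<in> ?D \<and> c' > c \<and> ?T (r, c') > ?T (r, c)} =
     card {r'. (r', c) \<in> ?D \<and> r' > r \<and> ?T (r', c) < ?T (r, c)}" .
qed

lemma exchange_SBT:
  assumes "w permutes {1..n}" "T \<in> SBT n w" "exchangeable n w T u v"
  shows "exchange T u v \<in> SBT n w"
  using assms exchange_standard exchange_balanced by (auto simp: SBT_def exchangeable_def)

section \<open>Coxeter moves\<close>

lemma c_move_exchange:
  assumes T: "standard_filling n w T" and uv: "u \<in> rothe n w" "v \<in> rothe n w" "T v = Suc (T u)"
    and "fst u \<noteq> fst v" "snd u \<noteq> snd v"
  shows "exchangeable n w T u v" "c_move n w (T u) T = exchange T u v"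
    "c_move n w (T u) \<in> coxeter_moves n w"
proof -
  show "exchangeable n w T u v" using assms by (auto simp: exchangeable_def)
  have "cell_of n w T (T u) = u" "cell_of n w T (Suc (T u)) = v"
    using cell_of_entry[OF T uv(1)] cell_of_entry[OF T uv(2)] uv(3) by simp_all
  then show "c_move n w (T u) T = exchange T u v"
    using assms by (simp add: c_move_def exchange_def row_of_def col_of_def)
  show "c_move n w (T u) \<in> coxeter_moves n w"
    using standard_filling_range[OF T uv(1)] standard_filling_range[OF T uv(2)] uv(3)
    by (auto simp: coxeter_moves_def)
qed

text \<open>Only the entry of \<open>(r, c)\<close> lies strictly between the exchanged ones, and
  the position test of the move makes \<open>(r, c)\<close> the corner that
  \<open>exchangeable\<close> asks for.\<close>

lemma b_move_exchange:
  assumes T: "standard_filling n w T"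
    and D: "(r, c) \<in> rothe n w" "u \<in> rothe n w" "v \<in> rothe n w"
    and e: "T (r, c) = Suc (T u)" "T v = Suc (T (r, c))"
    and uv: "u = (r', c) \<and> v = (r, c') \<or> u = (r, c') \<and> v = (r', c)" "r < r'" "c < c'"
  shows "exchangeable n w T u v" "b_move n w (T (r, c)) T = exchange T u v"
    "b_move n w (T (r, c)) \<in> coxeter_moves n w"
proof -
  have mid: "z = (r, c)" if "z \<in> rothe n w" "T u < T z \<and> T z < T v" for z
    using inj_onD[OF standard_fillingD(1)[OF T] _ that(1) D(1)] that e by simp
  have pos: "(snd u < snd v \<longleftrightarrow> fst v < fst u) \<and> (r, c) = (min (fst u) (fst v), min (snd u) (snd v))"
    "fst u \<noteq> fst v" "snd u \<noteq> snd v" using uv by auto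
  have "(snd u < snd v \<longleftrightarrow> fst v < fst u) \<and> z = (min (fst u) (fst v), min (snd u) (snd v))"
    if z: "z \<in> rothe n w" "T u < T z \<and> T z < T v" for z
    unfolding mid[OF z] by (rule pos(1))
  then show "exchangeable n w T u v"
    unfolding exchangeable_def using D e pos(2,3) by (auto simp only: less_Suc_eq)
  have c: "cell_of n w T (T (r, c) - 1) = u" "cell_of n w T (T (r, c)) = (r, c)"
     "cell_of n w T (T (r, c) + 1) = v"
    using cell_of_entry[OF T D(1)] cell_of_entry[OF T D(2)] cell_of_entry[OF T D(3)] e by simp_all
  have "T (r, c) - 1 = T u" "T (r, c) + 1 = T v" using e by simp_all
  then show "b_move n w (T (r, c)) T = exchange T u v"
    using c uv unfolding b_move_def exchange_def above_in_col_def right_in_row_def row_of_def col_of_def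
    by auto
  show "b_move n w (T (r, c)) \<in> coxeter_moves n w"
    using standard_filling_range[OF T D(2)] standard_filling_range[OF T D(3)] e
    by (auto simp: coxeter_moves_def)
qed

text \<open>Lets standardness and the change of the inversion number be proved once for exchanges,
  not separately for the two kinds of moves.\<close>

lemma coxeter_move_cases:
  assumes T: "standard_filling n w T" and f: "f \<in> coxeter_moves n w"
  obtains "f T = T" | u v where "exchangeable n w T u v" "f T = exchange T u v"
proof -
  consider i where "f = c_move n w i" "1 \<le> i" "i < perm_length n w"
    | i where "f = b_move n w i" "1 < i" "i < perm_length n w"
    using f by (auto simp: coxeter_moves_def)
  then show thesis
  proof cases
    case (1 i)
    show thesis
    proof (cases "row_of n w T i \<noteq> row_of n w T (i + 1) \<and> col_of n w T i \<noteq> col_of n w T (i + 1)")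
      case True
      let ?u = "cell_of n w T i" and ?v = "cell_of n w T (i + 1)"
      have "?u \<in> rothe n w" "?v \<in> rothe n w" "T ?u = i" "T ?v = i + 1"
        using cell_of_in[OF T] 1 by auto
      then show thesis
        using c_move_exchange[OF T, of ?u ?v] True that(2)[of ?u ?v] 1(1) by (auto simp: row_of_def col_of_def)
    next
      case False
      then show thesis using that(1) 1(1) by (simp only: c_move_def if_False)
    qed
  next
    case (2 i)
    let ?u = "cell_of n w T (i - 1)" and ?v = "cell_of n w T (i + 1)" and ?z = "cell_of n w T i"
    have D: "?u \<in> rothe n w" "?v \<in> rothe n w" "?z \<in> rothe n w"
      and e: "T ?u = i - 1" "T ?v = i + 1" "T ?z = i"
      using cell_of_in[OF T] 2 by auto
    obtain r c where z: "?z = (r, c)" by force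
    show thesis
    proof (cases "above_in_col n w T (i - 1) i \<and> right_in_row n w T (i + 1) i \<or>
         above_in_col n w T (i + 1) i \<and> right_in_row n w T (i - 1) i")
      case True
      then obtain r' c' where "?u = (r', c) \<and> ?v = (r, c') \<or> ?u = (r, c') \<and> ?v = (r', c)" "r < r'" "c < c'"
        unfolding above_in_col_def right_in_row_def row_of_def col_of_def z
        by (metis fst_conv prod.collapse snd_conv)
      then show thesis
        using b_move_exchange[OF T, of r c ?u ?v r' c'] D e z 2 that(2)[of ?u ?v] by simp
    next
      case False
      then show thesis using that(1) 2(1) by (simp only: b_move_def if_False)
    qed
  qed
qed

section \<open>The action of a single move\<close>

lemma coxeter_move_standard:
  assumes "standard_filling n w T" "f \<in> coxeter_moves n w"
  shows "standard_filling n w (f T)"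
  by (rule coxeter_move_cases[OF assms]) (use assms(1) in \<open>auto simp: exchangeable_def intro: exchange_standard\<close>)

lemma coxeter_move_inv_number:
  assumes "w permutes {1..n}" "standard_filling n w T" "f \<in> coxeter_moves n w"
  shows "inv_number n w (f T) \<le> Suc (inv_number n w T)"
  by (rule coxeter_move_cases[OF assms(2,3)]) (use inv_number_exchange(2)[OF assms(1,2)] in simp_all)

text \<open>Applying a move twice requires its position test in the changed filling; this locates
  the entries there.\<close>

lemma cell_of_transpose:
  assumes T: "standard_filling n w T" and "a \<in> {1..perm_length n w}" "b \<in> {1..perm_length n w}"
    and k: "k \<in> {1..perm_length n w}"
  shows "cell_of n w (transpose a b \<circ> T) k = cell_of n w T (transpose a b k)"
proof -
  let ?u = "cell_of n w T a" and ?v = "cell_of n w T b" and ?x = "cell_of n w T (transpose a b k)"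
  have "transpose a b k \<in> {1..perm_length n w}" using assms by (auto simp: transpose_def)
  then have x: "?x \<in> rothe n w" "(transpose a b \<circ> T) ?x = k" using cell_of_in[OF T] by auto
  have "?u \<in> rothe n w" "?v \<in> rothe n w" "T ?u = a" "T ?v = b" using assms cell_of_in[OF T] by auto
  then have "standard_filling n w (transpose a b \<circ> T)"
    using exchange_standard[OF T, of ?u ?v] by (simp add: exchange_def)
  then show ?thesis using cell_of_entry[OF _ x(1)] x(2) by metis
qed

text \<open>After a nontrivial move the exchanged cells have traded roles and, for a b-move, the
  cell of \<open>i\<close> has stayed. The position test is symmetric in the exchanged cells, so the
  move applies again and undoes itself.\<close>

lemma coxeter_move_involution:
  assumes T: "standard_filling n w T" and f: "f \<in> coxeter_moves n w"
  shows "f (f T) = T"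
proof -
  have tt: "transpose a b \<circ> (transpose a b \<circ> T) = T" for a b by (simp add: fun_eq_iff)
  consider i where "f = c_move n w i" "1 \<le> i" "i < perm_length n w"
    | i where "f = b_move n w i" "1 < i" "i < perm_length n w"
    using f by (auto simp: coxeter_moves_def)
  then show ?thesis
  proof cases
    case (1 i)
    let ?T = "transpose i (i + 1) \<circ> T"
    have "cell_of n w ?T i = cell_of n w T (i + 1)" "cell_of n w ?T (i + 1) = cell_of n w T i"
      using 1 cell_of_transpose[OF T, of i "i + 1"] by auto
    then show ?thesis using 1(1) tt
      by (auto simp: c_move_def row_of_def col_of_def)
  next
    case (2 i)
    let ?T = "transpose (i - 1) (i + 1) \<circ> T"
    have rng: "i - 1 \<in> {1..perm_length n w}" "i + 1 \<in> {1..perm_length n w}" "i \<in> {1..perm_length n w}"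
      using 2 by auto
    have "cell_of n w ?T (i - 1) = cell_of n w T (i + 1)" "cell_of n w ?T (i + 1) = cell_of n w T (i - 1)"
      "cell_of n w ?T i = cell_of n w T i"
      using 2(2) cell_of_transpose[OF T rng(1,2) rng(1)] cell_of_transpose[OF T rng(1,2) rng(2)]
        cell_of_transpose[OF T rng(1,2) rng(3)] by simp_all
    then show ?thesis using 2(1) tt
      by (auto simp: b_move_def above_in_col_def right_in_row_def row_of_def col_of_def)
  qed
qed

section \<open>Descending to the super-Yamanouchi tableau\<close>

lemma inv_number_super_yamanouchi:
  assumes w: "w permutes {1..n}"
  shows "inv_number n w (super_yamanouchi n w) = 0"
proof -
  let ?P = "super_yamanouchi n w" and ?L = "reading_cells n w"
  have nth: "?P (?L ! k) = Suc k" if "k < length ?L" for k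
    using arg_cong[OF super_yamanouchi_props(2)[OF w], of "\<lambda>xs. xs ! k"] that
      length_reading_cells[OF w] by (simp add: reverse_row_word_def del: upt_Suc)
  have "fst x \<le> fst y" if xy: "x \<in> rothe n w" "y \<in> rothe n w" "?P x < ?P y" for x y
  proof -
    obtain k l where "k < length ?L" "x = ?L ! k" "l < length ?L" "y = ?L ! l"
      using xy(1,2) set_reading_cells[OF w] by (metis in_set_conv_nth)
    then show ?thesis
      using xy(3) nth sorted_wrt_nth_less[OF sorted_reading_cells[of n w], of k l]
      by (auto simp: read_before_def)
  qed
  then have "cell_inversions n w ?P = {}" by (force simp: cell_inversions_def)
  moreover have "standard_filling n w ?P"
    using super_yamanouchi_in_SBT[OF w] by (simp add: SBT_def)
  ultimately show ?thesis using inv_number_eq by simp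
qed

text \<open>Under \<open>rows\<close> no smaller entry stands above any cell, so by balancedness no
  larger one stands to its right. Entries therefore increase along the reading order, and the
  increasing arrangement of all entries is unique.\<close>

lemma super_yamanouchi_eqI:
  assumes w: "w permutes {1..n}" and R: "R \<in> SBT n w"
    and rows: "\<And>x y. x \<in> rothe n w \<Longrightarrow> y \<in> rothe n w \<Longrightarrow> fst x < fst y \<Longrightarrow> R x < R y"
  shows "R = super_yamanouchi n w"
proof -
  let ?D = "rothe n w" and ?L = "reading_cells n w"
  have std: "standard_filling n w R" and bal: "balanced n w R" using R by (auto simp: SBT_def)
  have mono: "R x < R y" if xy: "x \<in> ?D" "y \<in> ?D" "read_before x y" for x y
  proof (cases "fst x < fst y")
    case True
    then show ?thesis using rows xy by blast
  next
    case False
    then obtain r c c' where eq: "y = (r, c)" "x = (r, c')" "c < c'"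
      using xy(3) by (cases x; cases y) (auto simp: read_before_def)
    have "{r'. (r', c) \<in> ?D \<and> r' > r \<and> R (r', c) < R (r, c)} = {}"
      using rows[of "(r, c)"] xy(2) eq by (auto simp: not_less intro: less_imp_le)
    then have "card {d. (r, d) \<in> ?D \<and> d > c \<and> R (r, d) > R (r, c)} = 0"
      using balancedD[OF bal, of r c] xy(2) eq by (simp only: card.empty)
    moreover have "finite {d. (r, d) \<in> ?D \<and> d > c \<and> R (r, d) > R (r, c)}"
      by (rule finite_subset[OF _ finite_imageI[OF finite_rothe[OF w], of snd]]) force
    ultimately have "\<not> R (r, c) < R (r, c')" using xy(1) eq by auto
    moreover have "R x \<noteq> R y"
      using inj_onD[OF standard_fillingD(1)[OF std] _ xy(1,2)] eq by auto
    ultimately show ?thesis using eq by simp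
  qed
  have "sorted_wrt (\<lambda>x y. R x < R y) ?L"
    by (rule sorted_wrt_mono_rel[OF _ sorted_reading_cells])
      (use mono set_reading_cells[OF w] in blast)
  then have "sorted_wrt (<) (map R ?L)" by (simp add: sorted_wrt_map)
  moreover have "set (map R ?L) = set [1..<Suc (perm_length n w)]"
    using standard_fillingD(2)[OF std] set_reading_cells[OF w] by auto
  ultimately have "map R ?L = [1..<Suc (perm_length n w)]"
    by (intro strict_sorted_equal) (auto simp del: upt_Suc)
  then show ?thesis
    using super_yamanouchi_ex1[OF w] super_yamanouchi_props[OF w] standard_fillingD(3)[OF std]
    unfolding reverse_row_word_def by blast
qed

lemma exists_decreasing_move:
  assumes w: "w permutes {1..n}" and R: "R \<in> SBT n w" and ne: "R \<noteq> super_yamanouchi n w"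
  obtains f u v where "f \<in> coxeter_moves n w" "exchangeable n w R u v" "fst v < fst u"
    "f R = exchange R u v"
proof (rule ccontr)
  assume "\<not> thesis"
  then have none: False
    if "f \<in> coxeter_moves n w" "exchangeable n w R u v" "f R = exchange R u v" "fst v < fst u" for f u v
    using that \<open>\<And>f u v. \<lbrakk>f \<in> coxeter_moves n w; exchangeable n w R u v; fst v < fst u;
      f R = exchange R u v\<rbrakk> \<Longrightarrow> thesis\<close> by blast
  let ?D = "rothe n w" and ?l = "perm_length n w" and ?cell = "cell_of n w R"
  define row where "row k = fst (?cell k)" for k
  have std: "standard_filling n w R" using R by (auto simp: SBT_def)
  note cell = cell_of_in[OF std] and cell_R = cell_of_entry[OF std]
  \<comment> \<open>The start \<open>m\<close> is variable: it is \<open>Suc i\<close> after the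
    last descent \<open>i\<close>, and 1 once descents are excluded.\<close>
  have up: "row a \<le> row b" if "m \<le> a" "a \<le> b" "b \<le> ?l"
    and m: "\<And>k. m \<le> k \<Longrightarrow> k < ?l \<Longrightarrow> row k \<le> row (Suc k)" for m a b
    using that(2,1,3)
  proof (induction b rule: dec_induct)
    case (step b)
    then show ?case using m[of b] by force
  qed simp
  have asc: "row k \<le> row (Suc k)" if "1 \<le> k" "k < ?l" for k
  proof (rule ccontr)
    assume k: "\<not> row k \<le> row (Suc k)"
    let ?K = "{k. 1 \<le> k \<and> k < ?l \<and> row (Suc k) < row k}"
    define i where "i = Max ?K"
    have fin: "finite ?K" by simp
    have "i \<in> ?K" unfolding i_def using k that by (intro Max_in) auto
    then have i: "1 \<le> i" "i < ?l" "row (Suc i) < row i" by auto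
    have after: "row k \<le> row (Suc k)" if "Suc i \<le> k" "k < ?l" for k
    proof (rule ccontr)
      assume "\<not> row k \<le> row (Suc k)"
      then have "k \<in> ?K" using that by auto
      then have "k \<le> i" unfolding i_def using fin by simp
      then show False using that by simp
    qed
    obtain b c where u: "?cell i = (b, c)" by force
    obtain a c' where v: "?cell (Suc i) = (a, c')" by force
    have uv: "(b, c) \<in> ?D" "R (b, c) = i" "(a, c') \<in> ?D" "R (a, c') = Suc i"
      using cell[of i] cell[of "Suc i"] u v i by auto
    have ab: "a < b" using i u v by (simp add: row_def)
    have "c' = c"
    proof (rule ccontr)
      assume "c' \<noteq> c"
      then have "fst (b, c) \<noteq> fst (a, c')" "snd (b, c) \<noteq> snd (a, c')" using ab by auto
      from c_move_exchange[OF std uv(1,3) _ this] show False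
        using none[of "c_move n w (R (b, c))" "(b, c)" "(a, c')"] uv ab by simp
    qed
    with uv obtain q where q: "c = w q" by (auto simp: rothe_def)
    note uv = uv[unfolded \<open>c' = c\<close> q]
    have inv: "(b, q) \<in> inversions n w" "(a, q) \<in> inversions n w"
      using uv in_rothe_iff[OF w] by blast+
    let ?S = "\<lambda>i j. R (i, w j)"
    have ho: "hook_ordered n w ?S" by (rule SBT_hook_ordered[OF w R])
    have winj: "w x = w y \<longleftrightarrow> x = y" for x y using permutes_inj[OF w] by (auto dest: injD)
    note H = ho[unfolded hook_ordered_def, rule_format, of a b q]
    \<comment> \<open>Otherwise \<open>a\<close>, \<open>b\<close>, \<open>q\<close> has pattern
      231, where the entry \<open>i\<close> of row \<open>b\<close> in column \<open>w q\<close>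
      would have to exceed the entry \<open>i + 1\<close> of row \<open>a\<close>.\<close>
    have "w b < w a"
    proof (rule ccontr)
      assume "\<not> w b < w a"
      then have "w a < w b" using winj[of a b] ab by auto
      then show False using H inv ab uv by auto
    qed
    then have ab_inv: "(a, b) \<in> inversions n w" using inv ab by auto
    \<comment> \<open>In the decreasing triple the corner entry \<open>i + 1\<close> lies between
      the other two, and \<open>i\<close> is below it.\<close>
    have gt: "?S a b > Suc i" using H inv ab uv \<open>w b < w a\<close> by auto
    have abD: "(a, w b) \<in> ?D" using ab_inv in_rothe_iff[OF w] by blast
    have le: "?S a b \<le> ?l" using standard_filling_range[OF std abD] by simp
    have rowS: "row (?S a b) = a" "row (Suc i) = a"
      using cell_R[OF abD] v by (auto simp: row_def)
    \<comment> \<open>The entry of \<open>(a, w b)\<close> comes after \<open>i + 1\<close> and is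
      in the same row. Rows weakly increase in between, so \<open>i + 2\<close> is in row
      \<open>a\<close> too.\<close>
    have "row (Suc i) \<le> row (Suc (Suc i))" using up[of "Suc i"] after gt le by simp
    moreover have "row (Suc (Suc i)) \<le> row (?S a b)" using up[of "Suc i"] after gt le by simp
    ultimately have "row (Suc (Suc i)) = a" using rowS by simp
    then obtain e where e: "?cell (Suc (Suc i)) = (a, e)" by (auto simp: row_def prod_eq_iff)
    have eD: "(a, e) \<in> ?D" "R (a, e) = Suc (Suc i)"
      using cell[of "Suc (Suc i)"] e gt le by auto
    then obtain d where d: "e = w d" by (auto simp: rothe_def)
    have ad: "(a, d) \<in> inversions n w" using eD d in_rothe_iff[OF w] by blast
    have injS: "inj_on (case_prod ?S) (inversions n w)"
      by (rule standard_filling_inj_on_inversions[OF w std])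
    have "d = b"
      by (rule hook_ordered_next[OF ho _ injS ab_inv inv(1) ad, of i])
        (use winj uv eD d gt in \<open>auto simp: inj_on_def\<close>)
    \<comment> \<open>The entries \<open>i\<close>, \<open>i + 1\<close>, \<open>i + 2\<close> now
      sit above the corner, at it and to its right, where a b-move lowers the inversion
      number.\<close>
    then have "(a, w q) \<in> ?D \<and> (b, w q) \<in> ?D \<and> (a, w b) \<in> ?D \<and> R (a, w q) = Suc (R (b, w q)) \<and>
        R (a, w b) = Suc (R (a, w q)) \<and> w q < w b"
      using uv eD d inv by auto
    then show False
      using b_move_exchange[OF std, of a "w q" "(b, w q)" "(a, w b)" b "w b"] ab
        none[of "b_move n w (R (a, w q))" "(b, w q)" "(a, w b)"] by simp
  qed
  have "R = super_yamanouchi n w"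
  proof (rule super_yamanouchi_eqI[OF w R], rule ccontr)
    fix x y assume xy: "x \<in> ?D" "y \<in> ?D" "fst x < fst y" "\<not> R x < R y"
    then have "row (R y) \<le> row (R x)"
      using up[of 1 "R y" "R x"] asc standard_filling_range[OF std] by simp
    then show False using xy cell_R by (simp add: row_def)
  qed
  then show False using ne by simp
qed

text \<open>A decreasing move leads to a tableau with one inversion less, which the induction
  hypothesis reaches; the same move, being an involution, leads back to \<open>R\<close>.\<close>

lemma apply_moves_reach:
  assumes w: "w permutes {1..n}" and "R \<in> SBT n w"
  shows "\<exists>fs. set fs \<subseteq> coxeter_moves n w \<and> length fs = inv_number n w R \<and>
    apply_moves fs (super_yamanouchi n w) = R"
  using assms(2)
proof (induction "inv_number n w R" arbitrary: R rule: less_induct)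
  case less
  have std: "standard_filling n w R" using less.prems by (simp add: SBT_def)
  show ?case
  proof (cases "R = super_yamanouchi n w")
    case True
    then show ?thesis
      by (intro exI[of _ "[]"]) (simp add: inv_number_super_yamanouchi[OF w] apply_moves_def)
  next
    case False
    obtain f u v where f: "f \<in> coxeter_moves n w" and uv: "exchangeable n w R u v" "fst v < fst u"
      and fR: "f R = exchange R u v"
      using exists_decreasing_move[OF w less.prems False] .
    have Suc: "inv_number n w R = Suc (inv_number n w (f R))"
      using inv_number_exchange(1)[OF w std uv] fR by simp
    have "f R \<in> SBT n w" using exchange_SBT[OF w less.prems uv(1)] fR by simp
    then obtain fs where "set fs \<subseteq> coxeter_moves n w" "length fs = inv_number n w (f R)"
      "apply_moves fs (super_yamanouchi n w) = f R"
      using less.hyps Suc by (metis lessI)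
    \<comment> \<open>The head of the list acts first, so the final move is appended.\<close>
    then have "set (fs @ [f]) \<subseteq> coxeter_moves n w \<and> length (fs @ [f]) = inv_number n w R \<and>
      apply_moves (fs @ [f]) (super_yamanouchi n w) = R"
      using f Suc coxeter_move_involution[OF std f] by (simp add: apply_moves_def)
    then show ?thesis by blast
  qed
qed

section \<open>Lower bound for the number of moves\<close>

lemma inv_number_apply_moves:
  assumes "w permutes {1..n}" "standard_filling n w T" "set gs \<subseteq> coxeter_moves n w"
  shows "inv_number n w (apply_moves gs T) \<le> inv_number n w T + length gs"
  using assms(2,3)
proof (induction gs arbitrary: T)
  case Nil
  then show ?case by (simp add: apply_moves_def)
next
  case (Cons g gs)
  then have g: "g \<in> coxeter_moves n w" by simp
  have "inv_number n w (apply_moves gs (g T)) \<le> inv_number n w (g T) + length gs"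
    using Cons.prems by (intro Cons.IH[OF coxeter_move_standard[OF Cons.prems(1) g]]) simp
  then show ?case
    using coxeter_move_inv_number[OF assms(1) Cons.prems(1) g] by (simp add: apply_moves_def)
qed

theorem theorem3p15:
  fixes n :: nat and w :: "nat \<Rightarrow> nat" and R :: filling
  assumes "w permutes {1..n}"
    and "R \<in> SBT n w"
  shows "(\<exists>fs. set fs \<subseteq> coxeter_moves n w \<and> length fs = inv_number n w R \<and>
            apply_moves fs (super_yamanouchi n w) = R) \<and>
         (\<forall>gs. set gs \<subseteq> coxeter_moves n w \<and> apply_moves gs (super_yamanouchi n w) = R \<longrightarrow>
            length gs \<ge> inv_number n w R)"
proof (intro conjI allI impI)
  show "\<exists>fs. set fs \<subseteq> coxeter_moves n w \<and> length fs = inv_number n w R \<and>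
      apply_moves fs (super_yamanouchi n w) = R"
    by (rule apply_moves_reach[OF assms])
next
  fix gs assume gs: "set gs \<subseteq> coxeter_moves n w \<and> apply_moves gs (super_yamanouchi n w) = R"
  have "standard_filling n w (super_yamanouchi n w)"
    using super_yamanouchi_in_SBT[OF assms(1)] by (simp add: SBT_def)
  then show "length gs \<ge> inv_number n w R"
    using inv_number_apply_moves[OF assms(1), of "super_yamanouchi n w" gs] gs
      inv_number_super_yamanouchi[OF assms(1)] by simp
qed

end
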